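(* Let $G$ be a finite reflection group acting on $\mathbb{R}^n$ with closed fundamental chamber $\mathcal{C}$, and let $C\subset\mathbb{R}^n$ be a nonempty closed set invariant under $G$ (that is, $gC=C$ for all $g\in G$). Then the following statements are true: (i) for every $x\in\mathcal{C}$, $\mathcal{P}_C(x)=C_G(x)\,[\mathcal{P}_C(x)\cap\mathcal{C}]\neq\emptyset$; (ii) for all $x,y\in\mathbb{R}^n$, $y\in\mathcal{P}_C(x)$ if and only if $\check y\in\mathcal{P}_C(\check x)$ and $\langle\check x,\check y\rangle=\langle x,y\rangle$; (iii) if $C$ is convex and $x\in\mathcal{C}$, then the (unique) projection $\mathcal{P}_C(x)$ belongs to $C\cap\mathcal{C}$.
   Context: A finite reflection group $G$ on $\mathbb{R}^n$ is a finite subgroup of the orthogonal group $O(n)$ generated by reflections $h_u$, $h_u x=(I-2uu^{T})x$, $u$ a unit vector. Its root system is $\Phi=\{u:\|u\|=1,\ h_u\in G\}$. A positive root system is a set $U\subset\Phi$ for which there is a linear functional $\ell:\mathbb{R}^n\to\mathbb{R}$ with $\ell(u)>0$ for all $u\in U$ and $\ell(u)<0$ for all $u\in\Phi\setminus U$. Fix a positive root system $U$; the closed fundamental chamber is $\mathcal{C}=\{x\in\mathbb{R}^n:\langle x,u\rangle\ge 0\ \forall u\in U\}$. The orbit of $x$ is $\mathcal{O}(x)=\{gx: g\in G\}$. It is a known fact that $\mathcal{O}(x)\cap\mathcal{C}$ is a singleton for every $x\in\mathbb{R}^n$; its unique element is denoted $\check x$. The stabiliser of $x$ is $C_G(x)=\{h\in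 G: hx=x\}$, and for a set $S\subset\mathbb{R}^n$, $C_G(x)[S]=\{hs: h\in C_G(x),\ s\in S\}$. Here $\langle x,y\rangle=x^{T}y$ and $\|\cdot\|$ is the Euclidean norm. The projection is the set-valued operator $\mathcal{P}_C(x)=\{y\in C:\|x-y\|=\min_{z\in C}\|x-z\|\}$; when $C$ is convex it is a singleton and is identified with its element. *)

theory Defs
  imports "HOL-Analysis.Analysis" "HOL-Algebra.Generated_Groups"
begin

definition orthogonal_group :: "(real^'n^'n) monoid" where
  "orthogonal_group = \<lparr>carrier = {A. orthogonal_matrix A}, mult = (**), one = mat 1\<rparr>"

text \<open>The matrix \<open>I - 2 u u\<^sup>T\<close>; a reflection only when \<open>u\<close> is a unit vector.\<close>

definition reflection_matrix :: "real^'n \<Rightarrow> real^'n^'n" where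
  "reflection_matrix u =
     mat 1 - 2 *\<^sub>R ((columnvector u :: real^1^'n) ** (rowvector u :: real^'n^1))"

definition finite_reflection_group :: "(real^'n^'n) set \<Rightarrow> bool" where
  "finite_reflection_group G \<longleftrightarrow>
     finite G \<and> subgroup G orthogonal_group \<and>
     (\<exists>R. (\<forall>u\<in>R. norm u = 1) \<and> G = generate orthogonal_group (reflection_matrix ` R))"

definition root_system :: "(real^'n^'n) set \<Rightarrow> (real^'n) set" where
  "root_system G = {u. norm u = 1 \<and> reflection_matrix u \<in> G}"

definition positive_root_system :: "(real^'n^'n) set \<Rightarrow> (real^'n) set \<Rightarrow> bool" where
  "positive_root_system G U \<longleftrightarrow>
     U \<subseteq> root_system G \<and>
     (\<exists>l :: real^'n \<Rightarrow> real. linear l \<and> (\<forall>u\<in>U. l u > 0) \<and> (\<forall>u\<in>root_system G - U. l u < 0))"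

definition fundamental_chamber :: "(real^'n) set \<Rightarrow> (real^'n) set" where
  "fundamental_chamber U = {x. \<forall>u\<in>U. x \<bullet> u \<ge> 0}"

definition group_orbit :: "(real^'n^'n) set \<Rightarrow> real^'n \<Rightarrow> (real^'n) set" where
  "group_orbit G x = {g *v x | g. g \<in> G}"

text \<open>When \<open>U\<close> is a positive root system of the finite reflection group \<open>G\<close>, the intersection
  below is a singleton; otherwise the value may be arbitrary.\<close>

definition chamber_rep :: "(real^'n^'n) set \<Rightarrow> (real^'n) set \<Rightarrow> real^'n \<Rightarrow> real^'n" where
  "chamber_rep G U x = the_elem (group_orbit G x \<inter> fundamental_chamber U)"

definition stabiliser :: "(real^'n^'n) set \<Rightarrow> real^'n \<Rightarrow> (real^'n^'n) set" where
  "stabiliser G x = {h \<in> G. h *v x = x}"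

definition matrix_set_act :: "(real^'n^'n) set \<Rightarrow> (real^'n) set \<Rightarrow> (real^'n) set" where
  "matrix_set_act H S = {h *v s | h s. h \<in> H \<and> s \<in> S}"

definition proj_set :: "(real^'n) set \<Rightarrow> real^'n \<Rightarrow> (real^'n) set" where
  "proj_set C x = {y \<in> C. \<forall>z\<in>C. norm (x - y) \<le> norm (x - z)}"

end

theory Submission
  imports Defs
begin

text \<open>Each \<open>g \<in> G\<close> is a word in simple reflections, where a positive root is simple if its
  reflection permutes the other positive roots. If \<open>x\<close> and \<open>g x\<close> lie in the chamber, then either the
  last letter of the word fixes \<open>x\<close> or the word can be shortened, so \<open>g x = x\<close>; hence chamber
  representatives are unique. If \<open>x\<close> is in the chamber, \<open>y\<close> is a nearest point of \<open>C\<close> to \<open>x\<close> and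
  \<open>y\<close> is on the wrong side of a root hyperplane, then reflecting \<open>y\<close> cannot bring it closer to
  \<open>x\<close>, which forces \<open>x\<close> to lie on the hyperplane. Such reflections increase the height of \<open>y\<close>, so
  finitely many of them, all fixing \<open>x\<close>, bring \<open>y\<close> into the chamber.\<close>

section \<open>Reflections and orthogonal matrices\<close>

text \<open>As maps rather than matrices, reflections compose along a list by \<open>foldr\<close>,
  and all computations reduce to inner products.\<close>

definition reflect :: "'a::real_inner \<Rightarrow> 'a \<Rightarrow> 'a" where
  "reflect u x = x - (2 * (x \<bullet> u)) *\<^sub>R u"

lemma reflection_matrix_apply:
  fixes u x :: "real^'n"
  shows "reflection_matrix u *v x = reflect u x"
proof -
  have outer: "(columnvector u :: real^1^'n) ** (rowvector u :: real^'n^1) = (\<chi> i j. u $ i * u $ j)"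
    by (simp add: vec_eq_iff matrix_matrix_mult_def columnvector_def rowvector_def)
  have "(\<chi> i j. u $ i * u $ j) *v x = (x \<bullet> u) *\<^sub>R u"
    by (simp add: vec_eq_iff matrix_vector_mult_def inner_vec_def sum_distrib_left
        mult.commute mult.left_commute)
  then show ?thesis
    unfolding reflection_matrix_def reflect_def outer matrix_vector_mult_diff_rdistrib
      scaleR_matrix_vector_assoc[symmetric] by simp
qed

lemma reflect_minus [simp]: "reflect (- u) x = reflect u x"
  by (simp add: reflect_def)

lemma reflect_self: "norm u = 1 \<Longrightarrow> reflect u u = - u"
  by (simp add: reflect_def dot_square_norm scaleR_2)

lemma reflect_reflect [simp]: "norm u = 1 \<Longrightarrow> reflect u (reflect u x) = x"
  by (simp add: reflect_def dot_square_norm inner_diff_left algebra_simps)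

lemma inner_reflect: "norm u = 1 \<Longrightarrow> reflect u x \<bullet> reflect u y = x \<bullet> y"
  by (simp add: reflect_def dot_square_norm inner_diff_left inner_diff_right inner_commute)

lemma linear_reflect: "linear (reflect u)"
  by (rule linearI) (simp_all add: reflect_def inner_add_left algebra_simps)

text \<open>The coefficient \<open>x \<bullet> u\<close> survives because \<open>f\<close> preserves
  inner products. This moves roots by group elements and moves reflections past words.\<close>

lemma conjugate_reflect:
  assumes "linear f" and "\<And>x y. f x \<bullet> f y = x \<bullet> y"
  shows "f (reflect u x) = reflect (f u) (f x)"
  by (simp add: reflect_def assms linear_diff linear_scale)

lemma linear_foldr_reflect: "linear (foldr reflect us)"
proof (induction us)
  case Nil
  then show ?case by (simp add: linear_id[unfolded id_def])
next
  case (Cons u us)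
  then show ?case using linear_compose[OF Cons linear_reflect[of u]] by (simp add: o_def)
qed

lemma inner_foldr_reflect:
  "\<forall>u\<in>set us. norm u = 1 \<Longrightarrow> foldr reflect us x \<bullet> foldr reflect us y = x \<bullet> y"
  by (induction us) (simp_all add: inner_reflect)

lemma orthogonal_matrix_inner:
  fixes A :: "real^'n^'n"
  assumes "orthogonal_matrix A"
  shows "(A *v x) \<bullet> (A *v y) = x \<bullet> y"
  using assms orthogonal_transformation_matrix[of "(*v) A"]
  by (simp add: orthogonal_transformation_def)

lemma group_orthogonal_group: "group (orthogonal_group :: (real^'n^'n) monoid)"
proof (rule groupI)
  fix A :: "real^'n^'n"
  assume "A \<in> carrier orthogonal_group"
  then show "\<exists>B\<in>carrier orthogonal_group. B \<otimes>\<^bsub>orthogonal_group\<^esub> A = \<one>\<^bsub>orthogonal_group\<^esub>"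
    by (intro bexI[of _ "transpose A"])
      (auto simp: orthogonal_group_def orthogonal_matrix_def)
qed (auto simp: orthogonal_group_def orthogonal_matrix_mul orthogonal_matrix_id matrix_mul_assoc)

section \<open>Simple reflections\<close>

locale reflection_group_with_roots =
  fixes G :: "(real^'n^'n) set" and U :: "(real^'n) set" and l :: "real^'n \<Rightarrow> real"
  assumes refl_group: "finite_reflection_group G"
    and U_subset: "U \<subseteq> root_system G"
    and linear_l: "linear l"
    and l_pos: "u \<in> U \<Longrightarrow> l u > 0"
    and l_neg: "u \<in> root_system G - U \<Longrightarrow> l u < 0"
begin

declare transpose_matrix_vector [simp del]

section \<open>The group and its roots\<close>

lemma finite_G: "finite G"
  and subgroup_G: "subgroup G orthogonal_group"
  using refl_group by (auto simp: finite_reflection_group_def)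

lemma one_in_G: "mat 1 \<in> G"
  using subgroup.one_closed[OF subgroup_G] by (simp add: orthogonal_group_def)

lemma mult_in_G: "g \<in> G \<Longrightarrow> h \<in> G \<Longrightarrow> g ** h \<in> G"
  using subgroup.m_closed[OF subgroup_G] by (simp add: orthogonal_group_def)

lemma orthogonal_G: "g \<in> G \<Longrightarrow> orthogonal_matrix g"
  using subgroup.subset[OF subgroup_G] by (auto simp: orthogonal_group_def)

lemma transpose_in_G:
  assumes "g \<in> G"
  shows "transpose g \<in> G"
proof -
  have "inv\<^bsub>orthogonal_group\<^esub> g = transpose g"
    by (rule group.inv_equality[OF group_orthogonal_group])
      (use orthogonal_G[OF assms] in \<open>auto simp: orthogonal_group_def orthogonal_matrix_def\<close>)
  then show ?thesis
    using subgroup.m_inv_closed[OF subgroup_G assms] by simp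
qed

lemma transpose_G_apply [simp]:
  assumes "g \<in> G"
  shows "transpose g *v (g *v x) = x" "g *v (transpose g *v x) = x"
  using orthogonal_G[OF assms]
  by (simp_all add: matrix_vector_mul_assoc orthogonal_matrix_def)

lemma inner_G: "g \<in> G \<Longrightarrow> (g *v x) \<bullet> (g *v y) = x \<bullet> y"
  by (simp add: orthogonal_matrix_inner orthogonal_G)

lemma norm_G: "g \<in> G \<Longrightarrow> norm (g *v x) = norm x"
  by (simp add: norm_eq_sqrt_inner inner_G)

lemma norm_root: "u \<in> root_system G \<Longrightarrow> norm u = 1"
  by (simp add: root_system_def)

lemma norm_U: "u \<in> U \<Longrightarrow> norm u = 1"
  using U_subset norm_root by blast

text \<open>Conjugating the reflection in \<open>u\<close> by \<open>g\<close> gives the reflection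
  in \<open>g *v u\<close>.\<close>

lemma root_image:
  assumes "g \<in> G" and "u \<in> root_system G"
  shows "g *v u \<in> root_system G"
proof -
  have "reflection_matrix (g *v u) *v x = (g ** reflection_matrix u ** transpose g) *v x" for x
    using conjugate_reflect[of "(*v) g" u "transpose g *v x"] assms
    by (simp add: inner_G reflection_matrix_apply matrix_vector_mul_assoc[symmetric])
  then have "reflection_matrix (g *v u) = g ** reflection_matrix u ** transpose g"
    by (simp add: matrix_eq)
  moreover have "g ** reflection_matrix u ** transpose g \<in> G"
    using assms by (intro mult_in_G transpose_in_G) (auto simp: root_system_def)
  ultimately show ?thesis
    using assms by (simp add: root_system_def norm_G)
qed

lemma root_reflect: "u \<in> root_system G \<Longrightarrow> v \<in> root_system G \<Longrightarrow> reflect u v \<in> root_system G"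
  using root_image[of "reflection_matrix u" v] by (simp add: reflection_matrix_apply root_system_def)

lemma root_minus: "u \<in> root_system G \<Longrightarrow> - u \<in> root_system G"
  using root_reflect[of u u] by (simp add: reflect_self norm_root)

lemma root_cases:
  assumes "u \<in> root_system G"
  shows "u \<in> U \<or> - u \<in> U"
  using assms l_neg[of u] l_neg[of "- u"] root_minus[OF assms] linear_neg[OF linear_l, of u] by force

lemma finite_U: "finite U"
proof (rule inj_on_finite)
  show "inj_on reflection_matrix U"
  proof (rule inj_onI)
    fix u v
    assume uv: "u \<in> U" "v \<in> U" "reflection_matrix u = reflection_matrix v"
    \<comment> \<open>The reflection in \<open>u\<close> negates \<open>u\<close>; as it is also the
      reflection in \<open>v\<close>, \<open>u\<close> is a multiple of \<open>v\<close>. The sign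
      is settled by \<open>l\<close>.\<close>
    then have "- u = reflect v u"
      by (metis reflect_self reflection_matrix_apply norm_U)
    then have "2 *\<^sub>R u = 2 *\<^sub>R ((u \<bullet> v) *\<^sub>R v)"
      by (simp add: reflect_def algebra_simps scaleR_2)
    then have eq: "u = (u \<bullet> v) *\<^sub>R v"
      by (metis real_vector.scale_left_imp_eq zero_neq_numeral)
    then have "\<bar>u \<bullet> v\<bar> = 1"
      using norm_U uv by (metis mult.right_neutral norm_scaleR)
    with eq have "u = v \<or> u = - v"
      by (metis abs_eq_iff abs_1 scaleR_minus1_left scaleR_one)
    then show "u = v"
      using l_pos[OF uv(1)] l_pos[OF uv(2)] linear_neg[OF linear_l, of v] by auto
  qed
  show "reflection_matrix ` U \<subseteq> G"
    using U_subset by (auto simp: root_system_def)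
qed (rule finite_G)

text \<open>Classically simple roots form a basis and this permutation property is a consequence.
  Taking it as the definition bypasses linear independence.\<close>

definition simple_roots :: "(real^'n) set" where
  "simple_roots = {a \<in> U. \<forall>v\<in>U - {a}. reflect a v \<in> U}"

definition simple_word :: "(real^'n) list \<Rightarrow> bool" where
  "simple_word as \<longleftrightarrow> set as \<subseteq> simple_roots"

lemma simple_word_norm: "simple_word as \<Longrightarrow> \<forall>u\<in>set as. norm u = 1"
  using norm_U by (auto simp: simple_word_def simple_roots_def)

text \<open>A non-simple positive root \<open>u\<close> satisfies \<open>v + w = 2 (v \<bullet> u) u\<close> for positive roots
  \<open>v\<close> and \<open>w\<close>; the lower one of them conjugates \<open>reflect u\<close> into the reflection of a root of
  smaller height.\<close>

lemma reflect_eq_simple_word: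
  assumes "u \<in> U"
  shows "\<exists>as. simple_word as \<and> reflect u = foldr reflect as"
  using assms
\<comment> \<open>Heights are real numbers, so the induction counts the positive roots of smaller
  height instead.\<close>
proof (induction "card {v \<in> U. l v < l u}" arbitrary: u rule: less_induct)
  case less
  have lower: "\<exists>as. simple_word as \<and> reflect v = foldr reflect as" if "v \<in> U" "l v < l u" for v
  proof (rule less.hyps[OF _ that(1)])
    show "card {w \<in> U. l w < l v} < card {w \<in> U. l w < l u}"
      using that finite_U by (intro psubset_card_mono) auto
  qed
  have conj: ?case if v: "v \<in> U" and c: "0 < v \<bullet> u" "v \<bullet> u < 1" and h: "l v \<le> (v \<bullet> u) * l u" for v
  proof -
    define b where "b = reflect v u"
    have lu: "0 < l u" "0 < l v" using l_pos less.prems v by auto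
    have lv: "l v < l u"
      using h mult_strict_right_mono[OF c(2) lu(1)] by simp
    have lb: "l b = l u - 2 * (v \<bullet> u) * l v"
      by (simp add: b_def reflect_def linear_diff linear_scale linear_l inner_commute)
    have "(v \<bullet> u) * l v < l u"
      using lv mult_strict_right_mono[OF c(2) lu(2)] by simp
    moreover have "0 < (v \<bullet> u) * l v"
      using c lu by simp
    \<comment> \<open>With \<open>p = (v \<bullet> u) * l v\<close> and \<open>0 < p < l u\<close>,
      the height \<open>l u - 2 * p\<close> lies strictly between \<open>- l u\<close> and
      \<open>l u\<close>. So whichever of \<open>b\<close> and \<open>- b\<close> is positive is
      covered by \<open>lower\<close>.\<close>
    ultimately have "l b < l u" "l (- b) < l u"
      using lb lu linear_neg[OF linear_l, of b] by (auto simp: mult.assoc)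
    moreover have "b \<in> root_system G"
      unfolding b_def using root_reflect U_subset v less.prems by blast
    ultimately obtain bs where bs: "simple_word bs" "reflect b = foldr reflect bs"
      using root_cases[of b] lower[of b] lower[of "- b"]
      by (auto simp: fun_eq_iff)
    obtain as where as: "simple_word as" "reflect v = foldr reflect as"
      using lower[OF v lv] by blast
    have "reflect v (reflect u x) = reflect b (reflect v x)" for x
      unfolding b_def by (rule conjugate_reflect[OF linear_reflect inner_reflect[OF norm_U[OF v]]])
    then have "reflect u x = reflect v (reflect b (reflect v x))" for x
      using reflect_reflect[OF norm_U[OF v]] by metis
    then have "reflect u = foldr reflect (as @ bs @ as)"
      using as bs by (simp add: fun_eq_iff)
    moreover have "simple_word (as @ bs @ as)"
      using as bs by (simp add: simple_word_def)
    ultimately show ?thesis by blast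
  qed
  show ?case
  proof (cases "u \<in> simple_roots")
    case True
    then show ?thesis
      by (intro exI[of _ "[u]"]) (simp add: simple_word_def fun_eq_iff)
  next
    case False
    then obtain v where v: "v \<in> U" "v \<noteq> u" "reflect u v \<notin> U"
      using less.prems by (auto simp: simple_roots_def)
    define w where "w = - reflect u v"
    have w: "w \<in> U"
      using root_cases[of "reflect u v"] root_reflect[of u v] U_subset v less.prems
      by (auto simp: w_def)
    have sum: "l v + l w = 2 * (v \<bullet> u) * l u"
      by (simp add: w_def reflect_def linear_diff linear_scale linear_neg linear_l)
    have wu: "w \<bullet> u = v \<bullet> u"
      using norm_U[OF less.prems]
      by (simp add: w_def reflect_def inner_diff_left dot_square_norm)
    have c0: "0 < v \<bullet> u"
      using sum l_pos[OF v(1)] l_pos[OF w] l_pos[OF less.prems]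
      by (smt (verit) mult_nonpos_nonneg)
    have "(v - u) \<bullet> (v - u) = 2 - 2 * (v \<bullet> u)"
      using norm_U[OF v(1)] norm_U[OF less.prems]
      by (simp add: norm_eq_1 inner_diff_left inner_diff_right inner_commute)
    moreover have "0 < (v - u) \<bullet> (v - u)"
      using v by simp
    ultimately have c1: "v \<bullet> u < 1"
      by linarith
    \<comment> \<open>The heights of \<open>v\<close> and \<open>w\<close> average to
      \<open>(v \<bullet> u) * l u\<close>, so one of them is at most that, and both have the same
      inner product with \<open>u\<close>.\<close>
    show ?thesis
      using conj[OF v(1) c0 c1] conj[OF w] c0 c1 wu sum by (cases "l v \<le> (v \<bullet> u) * l u") auto
  qed
qed

text \<open>Each generator is the reflection in a positive root, up to the sign of the root.
  Inverses add nothing because reflections are involutions, and products concatenate words.\<close>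

lemma G_eq_simple_word:
  assumes "g \<in> G"
  shows "\<exists>as. simple_word as \<and> (*v) g = foldr reflect as"
proof -
  obtain R where R: "\<forall>u\<in>R. norm u = 1" "G = generate orthogonal_group (reflection_matrix ` R)"
    using refl_group by (auto simp: finite_reflection_group_def)
  have refl: "\<exists>as. simple_word as \<and> (*v) (reflection_matrix u) = foldr reflect as" if "u \<in> R" for u
  proof -
    have "u \<in> root_system G"
      using R that generate.incl[of "reflection_matrix u" "reflection_matrix ` R" orthogonal_group]
      by (auto simp: root_system_def)
    then show ?thesis
      using root_cases[of u] reflect_eq_simple_word[of u] reflect_eq_simple_word[of "- u"]
      by (auto simp: fun_eq_iff reflection_matrix_apply)
  qed
  from assms have "g \<in> generate orthogonal_group (reflection_matrix ` R)"
    using R by simp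
  then show ?thesis
  proof (induction rule: generate.induct)
    case one
    then show ?case
      by (intro exI[of _ "[]"]) (simp add: simple_word_def fun_eq_iff orthogonal_group_def)
  next
    case (incl h)
    then show ?case using refl by auto
  next
    case (inv h)
    then obtain u where u: "u \<in> R" "h = reflection_matrix u" by auto
    have "h \<in> G"
      unfolding R(2) using inv by (rule generate.incl)
    then have h: "h \<in> carrier orthogonal_group"
      by (rule subgroup.mem_carrier[OF subgroup_G])
    have "h ** h = mat 1"
      using R u by (simp add: matrix_eq reflection_matrix_apply flip: matrix_vector_mul_assoc)
    then have "inv\<^bsub>orthogonal_group\<^esub> h = h"
      using h by (intro group.inv_equality[OF group_orthogonal_group]) (auto simp: orthogonal_group_def)
    then show ?case using refl u by simp
  next
    case (eng g h)
    then obtain as bs where "simple_word as" "(*v) g = foldr reflect as"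
      "simple_word bs" "(*v) h = foldr reflect bs" by blast
    then show ?case
      by (intro exI[of _ "as @ bs"])
        (simp add: simple_word_def fun_eq_iff orthogonal_group_def flip: matrix_vector_mul_assoc)
  qed
qed

section \<open>Uniqueness of the chamber representative\<close>

text \<open>An exchange condition. Letters act from the right; let \<open>a\<close> be the letter
  that first takes the image of \<open>b\<close> out of \<open>U\<close>. Simplicity forces that
  image to be \<open>a\<close> itself, so the letters already applied conjugate
  \<open>reflect b\<close> to \<open>reflect a\<close>, which cancels the letter
  \<open>a\<close>.\<close>

lemma word_shorten:
  assumes "simple_word as" and "b \<in> simple_roots" and "foldr reflect as b \<notin> U"
  shows "\<exists>bs. simple_word bs \<and> length bs < length as \<and>
    (\<forall>x. foldr reflect as (reflect b x) = foldr reflect bs x)"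
  using assms
proof (induction as)
  case Nil
  then show ?case by (simp add: simple_roots_def)
next
  case (Cons a as)
  then have as: "simple_word as" and a: "a \<in> simple_roots" by (auto simp: simple_word_def)
  show ?case
  proof (cases "foldr reflect as b \<in> U")
    case True
    then have ab: "foldr reflect as b = a"
      using a Cons.prems(3) by (auto simp: simple_roots_def)
    have "foldr reflect as (reflect b x) = reflect a (foldr reflect as x)" for x
      using conjugate_reflect[OF linear_foldr_reflect inner_foldr_reflect[OF simple_word_norm[OF as]]] ab
      by metis
    moreover have "norm a = 1"
      using a norm_U by (auto simp: simple_roots_def)
    ultimately show ?thesis
      using as by (intro exI[of _ as]) simp
  next
    case False
    then obtain bs where "simple_word bs" "length bs < length as"
      "\<forall>x. foldr reflect as (reflect b x) = foldr reflect bs x"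
      using Cons.IH[OF as Cons.prems(2)] by blast
    then show ?thesis
      using a by (intro exI[of _ "a # bs"]) (simp add: simple_word_def)
  qed
qed

lemma word_chamber_fixed:
  assumes "simple_word as" and "x \<in> fundamental_chamber U"
    and "foldr reflect as x \<in> fundamental_chamber U"
  shows "foldr reflect as x = x"
  using assms
\<comment> \<open>Length is the measure because the word supplied by \<open>word_shorten\<close>
  need not be a prefix of \<open>as\<close>.\<close>
proof (induction "length as" arbitrary: as rule: less_induct)
  case less
  show ?case
  proof (cases as rule: rev_cases)
    case Nil
    then show ?thesis by simp
  next
    case (snoc bs b)
    have bs: "simple_word bs" and b: "b \<in> simple_roots"
      using less.prems snoc by (auto simp: simple_word_def)
    have bU: "b \<in> U" "norm b = 1"
      using b norm_U by (auto simp: simple_roots_def)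
    show ?thesis
    proof (cases "foldr reflect bs b \<in> U")
      case False
      then obtain cs where "simple_word cs" "length cs < length bs"
        "\<forall>x. foldr reflect bs (reflect b x) = foldr reflect cs x"
        using word_shorten[OF bs b] by blast
      then show ?thesis
        using less.hyps[of cs] less.prems snoc by simp
    next
      case True
      have "0 \<le> foldr reflect bs (reflect b x) \<bullet> foldr reflect bs b"
        using less.prems(3) True snoc by (simp add: fundamental_chamber_def)
      also have "\<dots> = reflect b x \<bullet> b"
        by (rule inner_foldr_reflect[OF simple_word_norm[OF bs]])
      also have "\<dots> = - (x \<bullet> b)"
        using bU by (simp add: reflect_def inner_diff_left dot_square_norm)
      finally have "x \<bullet> b = 0"
        using less.prems(2) bU by (force simp: fundamental_chamber_def)
      then have "foldr reflect as x = foldr reflect bs x"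
        using snoc by (simp add: reflect_def)
      then show ?thesis
        using less.hyps[of bs] less.prems bs snoc by simp
    qed
  qed
qed

lemma chamber_fixed:
  assumes "g \<in> G" and "x \<in> fundamental_chamber U" and "g *v x \<in> fundamental_chamber U"
  shows "g *v x = x"
  using G_eq_simple_word[OF assms(1)] word_chamber_fixed assms by metis

section \<open>Nearest points\<close>

text \<open>At an \<open>h\<close> maximising \<open>l (h *v z)\<close> no root has negative inner
  product with \<open>h *v z\<close>, as reflecting in it would raise the height. Closure is asked
  only for such ascents, so that \<open>H\<close> can be \<open>G\<close> or the stabiliser of a
  point whose nearest point is being moved.\<close>

lemma highest_in_chamber:
  assumes "H \<subseteq> G" and "mat 1 \<in> H"
    and closed: "\<And>h u. h \<in> H \<Longrightarrow> u \<in> U \<Longrightarrow> (h *v z) \<bullet> u < 0 \<Longrightarrow> reflection_matrix u ** h \<in> H"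
  shows "\<exists>h\<in>H. h *v z \<in> fundamental_chamber U"
proof -
  have "finite H"
    using assms finite_G finite_subset by blast
  then have "finite ((\<lambda>h. l (h *v z)) ` H)" and "(\<lambda>h. l (h *v z)) ` H \<noteq> {}"
    using assms(2) by auto
  then obtain h where h: "h \<in> H" and max: "\<And>k. k \<in> H \<Longrightarrow> l (k *v z) \<le> l (h *v z)"
    using Max_in[of "(\<lambda>h. l (h *v z)) ` H"] Max_ge[of "(\<lambda>h. l (h *v z)) ` H"]
    by (smt (verit) imageE imageI)
  have "0 \<le> (h *v z) \<bullet> u" if u: "u \<in> U" for u
  proof (rule ccontr)
    assume neg: "\<not> 0 \<le> (h *v z) \<bullet> u"
    then have "l (reflect u (h *v z)) \<le> l (h *v z)"
      using max[OF closed[OF h u]]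
      by (simp add: reflection_matrix_apply flip: matrix_vector_mul_assoc)
    then have "0 \<le> ((h *v z) \<bullet> u) * l u"
      by (simp add: reflect_def linear_diff linear_scale linear_l mult.commute)
    with neg l_pos[OF u] show False
      by (simp add: zero_le_mult_iff)
  qed
  with h show ?thesis
    by (auto simp: fundamental_chamber_def)
qed

text \<open>\<open>h ** transpose g\<close> carries one chamber point of the orbit to another, so
  \<open>chamber_fixed\<close> identifies them and \<open>the_elem\<close> is applied to a
  singleton.\<close>

lemma chamber_rep_eq:
  assumes "g \<in> G" and "g *v x \<in> fundamental_chamber U"
  shows "chamber_rep G U x = g *v x"
proof -
  have "h *v x = g *v x" if "h \<in> G" "h *v x \<in> fundamental_chamber U" for h
    using chamber_fixed[of "h ** transpose g" "g *v x"] assms that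
    by (simp add: mult_in_G transpose_in_G flip: matrix_vector_mul_assoc)
  then have "group_orbit G x \<inter> fundamental_chamber U = {g *v x}"
    using assms unfolding group_orbit_def by blast
  then show ?thesis
    by (simp add: chamber_rep_def)
qed

lemma chamber_rep_obtain:
  obtains g where "g \<in> G" "g *v x \<in> fundamental_chamber U" "chamber_rep G U x = g *v x"
proof -
  have "reflection_matrix u ** h \<in> G" if "h \<in> G" "u \<in> U" for h u
    using that U_subset mult_in_G by (auto simp: root_system_def)
  then show ?thesis
    using highest_in_chamber[of G x] one_in_G chamber_rep_eq that by blast
qed

section \<open>Projections onto an invariant set\<close>

context
  fixes C :: "(real^'n) set"
  assumes invariant: "\<forall>g\<in>G. (\<lambda>x. g *v x) ` C = C"
begin

lemma invariant_mem:
  assumes "g \<in> G"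
  shows "g *v y \<in> C \<longleftrightarrow> y \<in> C"
proof -
  have "inj ((*v) g)"
    by (rule inj_on_inverseI[of _ "(*v) (transpose g)"]) (simp add: assms)
  then have "g *v y \<in> (*v) g ` C \<longleftrightarrow> y \<in> C"
    by (rule inj_image_mem_iff)
  then show ?thesis
    using bspec[OF invariant assms] by simp
qed

lemma proj_set_act:
  assumes "g \<in> G" and "y \<in> proj_set C x"
  shows "g *v y \<in> proj_set C (g *v x)"
proof -
  have "norm (g *v x - g *v y) \<le> norm (g *v x - z)" if "z \<in> C" for z
  proof -
    have "norm (g *v x - g *v y) = norm (x - y)"
      using norm_G[OF assms(1), of "x - y"] by (simp add: matrix_vector_mult_diff_distrib)
    \<comment> \<open>The competitor \<open>z\<close> is pulled back by the inverse of
      \<open>g\<close>, which keeps it in \<open>C\<close>.\<close>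
    also have "\<dots> \<le> norm (x - transpose g *v z)"
      using assms that transpose_in_G by (simp add: proj_set_def invariant_mem)
    also have "\<dots> = norm (g *v x - z)"
      using norm_G[OF assms(1), of "x - transpose g *v z"] assms
      by (simp add: matrix_vector_mult_diff_distrib)
    finally show ?thesis .
  qed
  then show ?thesis
    using assms by (simp add: proj_set_def invariant_mem)
qed

lemma proj_set_stabiliser:
  assumes x: "x \<in> fundamental_chamber U" and y: "y \<in> proj_set C x"
  shows "\<exists>h\<in>stabiliser G x. h *v y \<in> fundamental_chamber U"
proof (rule highest_in_chamber)
  show "stabiliser G x \<subseteq> G" "mat 1 \<in> stabiliser G x"
    by (auto simp: stabiliser_def one_in_G)
next
  fix h u
  assume h: "h \<in> stabiliser G x" and u: "u \<in> U" and neg: "(h *v y) \<bullet> u < 0"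
  then have hG: "h \<in> G" "h *v x = x" by (auto simp: stabiliser_def)
  have uG: "reflection_matrix u \<in> G"
    using u U_subset by (auto simp: root_system_def)
  define w where "w = h *v y"
  have w: "w \<in> proj_set C x"
    using proj_set_act[OF hG(1) y] hG by (simp add: w_def)
  then have "reflect u w \<in> C"
    using invariant_mem[OF uG, of w] by (simp add: proj_set_def reflection_matrix_apply)
  then have "norm (x - w) \<le> norm (x - reflect u w)"
    using w by (simp add: proj_set_def)
  then have "(x - w) \<bullet> (x - w) \<le> (x - reflect u w) \<bullet> (x - reflect u w)"
    by (simp add: norm_eq_sqrt_inner)
  \<comment> \<open>Since \<open>w\<close> and \<open>reflect u w\<close> have equal norm, comparing
    distances to \<open>x\<close> amounts to comparing inner products with \<open>x\<close>.\<close>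
  then have "x \<bullet> reflect u w \<le> x \<bullet> w"
    using inner_reflect[OF norm_U[OF u], of w w]
    by (simp add: inner_diff_left inner_diff_right inner_commute)
  then have "0 \<le> (w \<bullet> u) * (x \<bullet> u)"
    by (simp add: reflect_def inner_diff_right)
  with neg x u have "x \<bullet> u = 0"
    by (force simp: w_def fundamental_chamber_def zero_le_mult_iff)
  then show "reflection_matrix u ** h \<in> stabiliser G x"
    using hG uG
    by (simp add: stabiliser_def mult_in_G reflection_matrix_apply reflect_def
        flip: matrix_vector_mul_assoc)
qed

lemma proj_set_eq_stabiliser_act:
  assumes x: "x \<in> fundamental_chamber U"
  shows "proj_set C x = matrix_set_act (stabiliser G x) (proj_set C x \<inter> fundamental_chamber U)"
proof (intro equalityI subsetI)
  fix y
  assume y: "y \<in> proj_set C x"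
  then obtain h where h: "h \<in> G" "h *v x = x" "h *v y \<in> fundamental_chamber U"
    using proj_set_stabiliser[OF x] by (auto simp: stabiliser_def)
  \<comment> \<open>The element bringing \<open>y\<close> into the chamber fixes \<open>x\<close>,
    hence so does its inverse, which leads back to \<open>y\<close>.\<close>
  then have "transpose h \<in> stabiliser G x"
    using transpose_G_apply(1)[OF h(1), of x] transpose_in_G by (simp add: stabiliser_def)
  moreover have "h *v y \<in> proj_set C x"
    using proj_set_act[OF h(1) y] h by simp
  moreover have "y = transpose h *v (h *v y)"
    using h by simp
  ultimately show "y \<in> matrix_set_act (stabiliser G x) (proj_set C x \<inter> fundamental_chamber U)"
    using h unfolding matrix_set_act_def by blast
next
  fix y
  assume "y \<in> matrix_set_act (stabiliser G x) (proj_set C x \<inter> fundamental_chamber U)"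
  then show "y \<in> proj_set C x"
    using proj_set_act[of _ _ x] by (force simp: matrix_set_act_def stabiliser_def)
qed

lemma proj_set_chamber_rep:
  "y \<in> proj_set C x \<longleftrightarrow>
    chamber_rep G U y \<in> proj_set C (chamber_rep G U x) \<and>
    chamber_rep G U x \<bullet> chamber_rep G U y = x \<bullet> y"
proof -
  obtain g where g: "g \<in> G" "g *v x \<in> fundamental_chamber U" "chamber_rep G U x = g *v x"
    by (rule chamber_rep_obtain)
  obtain k where k: "k \<in> G" "k *v y \<in> fundamental_chamber U" "chamber_rep G U y = k *v y"
    by (rule chamber_rep_obtain)
  show ?thesis
  proof
    assume "y \<in> proj_set C x"
    then have gy: "g *v y \<in> proj_set C (g *v x)"
      using proj_set_act g by blast
    then obtain h where h: "h \<in> G" "h *v (g *v x) = g *v x" "h *v (g *v y) \<in> fundamental_chamber U"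
      using proj_set_stabiliser[OF g(2)] by (auto simp: stabiliser_def)
    \<comment> \<open>The single element \<open>h ** g\<close> now yields both representatives, as
      \<open>h\<close> fixes \<open>g *v x\<close>; it therefore preserves the inner product of
      \<open>x\<close> and \<open>y\<close>.\<close>
    have rep: "chamber_rep G U y = h *v (g *v y)"
      using chamber_rep_eq[of "h ** g" y] h g by (simp add: mult_in_G flip: matrix_vector_mul_assoc)
    moreover have "h *v (g *v y) \<in> proj_set C (g *v x)"
      using proj_set_act[OF h(1) gy] h by simp
    moreover have "(g *v x) \<bullet> (h *v (g *v y)) = x \<bullet> y"
      using inner_G[OF h(1), of "g *v x" "g *v y"] inner_G[OF g(1)] h by simp
    ultimately show "chamber_rep G U y \<in> proj_set C (chamber_rep G U x) \<and>
        chamber_rep G U x \<bullet> chamber_rep G U y = x \<bullet> y"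
      using g by simp
  next
    assume "chamber_rep G U y \<in> proj_set C (chamber_rep G U x) \<and>
      chamber_rep G U x \<bullet> chamber_rep G U y = x \<bullet> y"
    then have ky: "k *v y \<in> proj_set C (g *v x)" and inner: "(g *v x) \<bullet> (k *v y) = x \<bullet> y"
      using g k by auto
    \<comment> \<open>Here \<open>g\<close> and \<open>k\<close> may differ: norms are invariant
      separately, and only the mixed term uses the hypothesis on inner products.\<close>
    have "(g *v x - k *v y) \<bullet> (g *v x - k *v y) = (x - y) \<bullet> (x - y)"
      using inner by (simp add: inner_diff_left inner_diff_right inner_G g k inner_commute)
    then have "norm (g *v x - k *v y) = norm (x - y)"
      by (simp add: norm_eq_sqrt_inner)
    moreover have "norm (g *v x - g *v z) = norm (x - z)" for z
      using norm_G[OF g(1), of "x - z"] by (simp add: matrix_vector_mult_diff_distrib)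
    ultimately have "norm (x - y) \<le> norm (x - z)" if "z \<in> C" for z
      using ky that invariant_mem[OF g(1), of z] unfolding proj_set_def by fastforce
    moreover have "y \<in> C"
      using ky invariant_mem[OF k(1)] by (simp add: proj_set_def)
    ultimately show "y \<in> proj_set C x"
      by (simp add: proj_set_def)
  qed
qed

end

end

lemma proj_set_nonempty:
  assumes "closed C" and "C \<noteq> {}"
  shows "proj_set C x \<noteq> {}"
  by (rule distance_attains_inf[OF assms, of x]) (auto simp: proj_set_def dist_norm)

lemma proj_set_unique:
  assumes "closed C" and "convex C" and "y \<in> proj_set C x" and "z \<in> proj_set C x"
  shows "y = z"
  using assms any_closest_point_unique[of C y z x] by (auto simp: proj_set_def dist_norm)

theorem theorem2:
  fixes G :: "(real^'n^'n) set" and U C :: "(real^'n) set"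
  assumes "finite_reflection_group G"
    and "positive_root_system G U"
    and "C \<noteq> {}" and "closed C"
    and "\<forall>g\<in>G. (\<lambda>x. g *v x) ` C = C"
  shows "(\<forall>x\<in>fundamental_chamber U.
            proj_set C x = matrix_set_act (stabiliser G x) (proj_set C x \<inter> fundamental_chamber U) \<and>
            proj_set C x \<noteq> {}) \<and>
         (\<forall>x y. y \<in> proj_set C x \<longleftrightarrow>
            chamber_rep G U y \<in> proj_set C (chamber_rep G U x) \<and>
            chamber_rep G U x \<bullet> chamber_rep G U y = x \<bullet> y) \<and>
         (convex C \<longrightarrow> (\<forall>x\<in>fundamental_chamber U.
            \<exists>p. proj_set C x = {p} \<and> p \<in> C \<inter> fundamental_chamber U))"
proof -
  obtain l :: "real^'n \<Rightarrow> real" where "reflection_group_with_roots G U l"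
    using assms(1,2) unfolding positive_root_system_def reflection_group_with_roots_def by blast
  then interpret reflection_group_with_roots G U l .
  note part_i = proj_set_eq_stabiliser_act[OF assms(5)]
  have nonempty: "proj_set C x \<noteq> {}" for x
    using assms(3,4) by (rule proj_set_nonempty[rotated])
  have "\<exists>p. proj_set C x = {p} \<and> p \<in> C \<inter> fundamental_chamber U"
    if "convex C" "x \<in> fundamental_chamber U" for x
  proof -
    \<comment> \<open>If no nearest point lay in the chamber, the right side of
      \<open>part_i\<close> would be empty.\<close>
    from part_i[OF that(2)] nonempty[of x] obtain p
      where p: "p \<in> proj_set C x" "p \<in> fundamental_chamber U"
      by (auto simp: matrix_set_act_def)
    then have "proj_set C x = {p}"
      using proj_set_unique[OF assms(4) that(1)] by blast
    with p show ?thesis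
      by (auto simp: proj_set_def)
  qed
  with part_i nonempty proj_set_chamber_rep[OF assms(5)] show ?thesis
    by blast
qed

end
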